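(* For all positive integers $k$ and nonnegative integers $n$, $$f^{\delta_{n+2k}/\delta_n}=2^{k(2n+2k-1)}\,(k(2n+2k-1))!\,\prod_{i=1}^{k}\frac{(2i-1)!}{(2n+2i+2k-2)!}\;\mathrm{OOT}(\delta_{n+2k}/\delta_n).$$
   Context: $\delta_n=(n-1,n-2,\dots,1)$ is the staircase partition, with $\delta_0=\delta_1=\varnothing$. $f^{\lambda/\mu}$ is the number of standard Young tableaux of skew shape $\lambda/\mu$. For partitions $[\mu]\subseteq[\lambda]$, with $\lambda$ having $d$ (positive) parts, $\mathrm{OOT}(\lambda/\mu)$ is the number of semistandard Young tableaux $T$ of shape $\mu$ with entries in $\{1,\dots,d\}$ such that $c(u)<\lambda_{d+1-T(u)}$ for all $u\in[\mu]$, where $c(i,j)=j-i$. *)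

theory Defs
  imports Complex_Main "HOL-Library.FuncSet"
begin

text \<open>
  A partition is the list of its positive parts in weakly decreasing order. Rows, columns and
  parts are numbered from 1, and the first coordinate of a cell is its row.
\<close>

definition is_partition :: "nat list \<Rightarrow> bool" where
  "is_partition lam \<longleftrightarrow> sorted_wrt (\<ge>) lam \<and> 0 \<notin> set lam"

definition part :: "nat list \<Rightarrow> nat \<Rightarrow> nat" where
  "part lam i = (if 1 \<le> i \<and> i \<le> length lam then lam ! (i - 1) else 0)"

definition staircase :: "nat \<Rightarrow> nat list" where
  "staircase n = rev [1..<n]"

lemma is_partition_staircase: "is_partition (staircase n)"
  by (auto simp: is_partition_def staircase_def sorted_wrt_rev)

definition diagram :: "nat list \<Rightarrow> (nat \<times> nat) set" where
  "diagram lam = {(i, j). 1 \<le> i \<and> 1 \<le> j \<and> j \<le> part lam i}"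

definition skew_diagram :: "nat list \<Rightarrow> nat list \<Rightarrow> (nat \<times> nat) set" where
  "skew_diagram lam mu = diagram lam - diagram mu"

text \<open>
  Fillings are extensional functions, constant outside the diagram, so that cardinalities of
  sets of tableaux count actual fillings.
\<close>

definition standard_tableaux :: "nat list \<Rightarrow> nat list \<Rightarrow> (nat \<times> nat \<Rightarrow> nat) set" where
  "standard_tableaux lam mu =
    {T \<in> extensional (skew_diagram lam mu).
       bij_betw T (skew_diagram lam mu) {1..card (skew_diagram lam mu)} \<and>
       (\<forall>i j j'. (i, j) \<in> skew_diagram lam mu \<longrightarrow> (i, j') \<in> skew_diagram lam mu \<longrightarrow> j < j' \<longrightarrow>
          T (i, j) < T (i, j')) \<and>
       (\<forall>i i' j. (i, j) \<in> skew_diagram lam mu \<longrightarrow> (i', j) \<in> skew_diagram lam mu \<longrightarrow> i < i' \<longrightarrow>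
          T (i, j) < T (i', j))}"

definition num_SYT :: "nat list \<Rightarrow> nat list \<Rightarrow> nat" where
  "num_SYT lam mu = card (standard_tableaux lam mu)"

definition semistandard_tableaux :: "nat list \<Rightarrow> nat \<Rightarrow> (nat \<times> nat \<Rightarrow> nat) set" where
  "semistandard_tableaux mu d =
    {T \<in> diagram mu \<rightarrow>\<^sub>E {1..d}.
       (\<forall>i j j'. (i, j) \<in> diagram mu \<longrightarrow> (i, j') \<in> diagram mu \<longrightarrow> j < j' \<longrightarrow>
          T (i, j) \<le> T (i, j')) \<and>
       (\<forall>i i' j. (i, j) \<in> diagram mu \<longrightarrow> (i', j) \<in> diagram mu \<longrightarrow> i < i' \<longrightarrow>
          T (i, j) < T (i', j))}"

definition content :: "nat \<times> nat \<Rightarrow> int" where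
  "content u = int (snd u) - int (fst u)"

definition OOT :: "nat list \<Rightarrow> nat list \<Rightarrow> nat" where
  "OOT lam mu = card {T \<in> semistandard_tableaux mu (length lam).
     \<forall>u \<in> diagram mu. content u < int (part lam (length lam + 1 - T u))}"

end

theory Submission
  imports Defs "Jordan_Normal_Form.Determinant"
begin

text \<open>
  Both numbers are determinants, and the two matrices differ by an explicit unitriangular factor
  and a rescaling of rows and columns.

  Put \<open>d = n + 2k - 1\<close>, so that the outer shape has the \<open>d\<close> parts \<open>d, d - 1, ..., 1\<close>; let
  \<open>m\<^sub>i\<close> with \<open>0 \<le> i < d\<close> be the parts of the inner shape padded by zeros, let
  \<open>s\<^sub>i = m\<^sub>i + d - i\<close>, and let \<open>N\<close> be the number of cells between the two shapes.

  \<^item> Aitken's formula (theorem \<open>aitken_formula\<close>) gives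
    \<open>f = N! det(1 / (2(d - i) - s\<^sub>j)!)\<close>, where the reciprocal factorial of a negative number is 0.
    It holds because both sides obey the same recursion for the removal of the largest entry: in the
    Leibniz expansion, lowering one row and summing over the choice of that row multiplies each term
    by its total degree \<open>N\<close>.

  \<^item> For the Okounkov--Olshanski tableaux the condition on contents says that \<open>T(i, j) > j - i\<close>.
    The columns then behave like \<open>d\<close> walkers which must not collide: between the entries \<open>t - 1\<close> and
    \<open>t\<close> every column grows by at most one cell, and the \<open>j\<close>-th column starts growing at \<open>t = j\<close>.
    Hence (theorem \<open>card_flagged_tableaux_eq_det\<close>) the number of these tableaux whose column lengths
    are \<open>m\<^sub>i\<close> is the determinant of the coefficients of \<open>x^(s\<^sub>i)\<close> in \<open>(x + x^2)^(d - j)\<close>.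

  \<^item> Since \<open>x + x^2 + 1/4 = (x + 1/2)^2\<close>, passing from the powers of \<open>x + x^2\<close> to the even powers of
    \<open>x + 1/2\<close> is unitriangular, so it preserves this determinant (lemma \<open>det_quad_coeff\<close>). The new
    entries are \<open>binomial(2(d - j), s\<^sub>i) 2^(s\<^sub>i - 2(d - j))\<close>; taking the factorials and the powers of 2
    out of rows and columns leaves Aitken's matrix.

  Together (theorem \<open>card_SYT_staircase_minus_partition\<close>) this compares, for every partition inside a
  staircase, the skew standard tableaux with the flagged tableaux of the conjugate shape. A staircase is
  its own conjugate, and for it most of the factorials of the two determinants cancel.
\<close>

section \<open>Determinants given by their entries\<close>

lemma det_mat_eq_sum:
  "det (mat d d (\<lambda>(i, j). f i j)) =
    (\<Sum>p | p permutes {0..<d}. signof p * (\<Prod>i = 0..<d. f i (p i)))"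
  by (subst det_def'[of _ d]) (auto intro!: sum.cong prod.cong simp: permutes_nat_less)

lemma det_mat_eq_sum':
  "det (mat d d (\<lambda>(i, j). f i j)) =
    (\<Sum>p | p permutes {0..<d}. signof p * (\<Prod>j = 0..<d. f (p j) j))"
  by (subst det_col[of _ d]) (auto intro!: sum.cong prod.cong simp: permutes_nat_less atLeast0LessThan)

lemma det_mat_transpose:
  "det (mat d d (\<lambda>(i, j). f j i)) = det (mat d d (\<lambda>(i, j). f i j))"
  by (subst det_mat_eq_sum', subst det_mat_eq_sum) (rule refl)

lemma det_mat_scale:
  "det (mat d d (\<lambda>(i, j). u i * f i j * v j)) =
    (\<Prod>i<d. u i) * det (mat d d (\<lambda>(i, j). f i j)) * (\<Prod>j<d. v j)"
proof -
  have "signof p * (\<Prod>i = 0..<d. u i * f i (p i) * v (p i)) =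
      (\<Prod>i<d. u i) * (signof p * (\<Prod>i = 0..<d. f i (p i))) * (\<Prod>j<d. v j)"
    if "p permutes {0..<d}" for p
  proof -
    have "(\<Prod>i = 0..<d. v (p i)) = (\<Prod>j = 0..<d. v j)"
      using prod.permute[OF that, of v] by (simp add: o_def)
    then show ?thesis
      by (simp add: prod.distrib atLeast0LessThan mult_ac)
  qed
  then show ?thesis
    unfolding det_mat_eq_sum by (simp add: sum_distrib_left sum_distrib_right)
qed

text \<open>
  Multilinearity in all rows at once: \<open>E\<close> is the set of rows in which the second summand is chosen.
\<close>
lemma det_mat_rows_add:
  "det (mat d d (\<lambda>(i, j). f i j + g i j)) =
    (\<Sum>E \<in> Pow {..<d}. det (mat d d (\<lambda>(i, j). if i \<in> E then g i j else f i j)))"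
proof -
  have *: "(\<Prod>i = 0..<d. f i (p i) + g i (p i)) =
      (\<Sum>E \<in> Pow {..<d}. \<Prod>i = 0..<d. if i \<in> E then g i (p i) else f i (p i))" for p
  proof -
    have "(\<Prod>i\<in>{..<d}. g i (p i) + f i (p i)) =
        (\<Sum>E \<in> Pow {..<d}. (\<Prod>i\<in>E. g i (p i)) * (\<Prod>i\<in>{..<d} - E. f i (p i)))"
      by (rule prod_add) simp
    also have "\<dots> = (\<Sum>E \<in> Pow {..<d}. \<Prod>i = 0..<d. if i \<in> E then g i (p i) else f i (p i))"
    proof (rule sum.cong[OF refl])
      fix E assume "E \<in> Pow {..<d}"
      then have "{..<d} \<inter> E = E" by auto
      then show "(\<Prod>i\<in>E. g i (p i)) * (\<Prod>i\<in>{..<d} - E. f i (p i)) =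
          (\<Prod>i = 0..<d. if i \<in> E then g i (p i) else f i (p i))"
        by (simp add: prod.If_cases atLeast0LessThan Diff_eq Int_commute)
    qed
    finally show ?thesis by (simp add: add.commute atLeast0LessThan)
  qed
  show ?thesis
    unfolding det_mat_eq_sum * sum_distrib_left by (rule sum.swap)
qed

lemma det_mat_equal_rows:
  assumes "i \<noteq> i'" "i < d" "i' < d" "\<And>j. j < d \<Longrightarrow> f i j = f i' j"
  shows "det (mat d d (\<lambda>(i, j). f i j)) = 0"
  by (rule det_identical_rows[of _ d i i']) (use assms in \<open>auto simp: Matrix.row_def intro!: eq_vecI\<close>)

lemma det_mat_zero_row:
  assumes "i < d" "\<And>j. j < d \<Longrightarrow> f i j = 0"
  shows "det (mat d d (\<lambda>(i, j). f i j)) = 0"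
  unfolding det_mat_eq_sum
proof (intro sum.neutral ballI)
  fix p assume "p \<in> {p. p permutes {0..<d}}"
  then have "p i < d"
    using assms(1) permutes_nat_less by blast
  then have "(\<Prod>i = 0..<d. f i (p i)) = 0"
    by (intro prod_zero bexI[of _ i]) (use assms in auto)
  then show "signof p * (\<Prod>i = 0..<d. f i (p i)) = 0" by simp
qed

lemma det_mat_zero_column:
  assumes "j < d" "\<And>i. i < d \<Longrightarrow> f i j = 0"
  shows "det (mat d d (\<lambda>(i, j). f i j)) = 0"
  unfolding det_mat_eq_sum'
proof (intro sum.neutral ballI)
  fix p assume "p \<in> {p. p permutes {0..<d}}"
  then have "p j < d"
    using assms(1) permutes_nat_less by blast
  then have "(\<Prod>j = 0..<d. f (p j) j) = 0"
    by (intro prod_zero bexI[of _ j]) (use assms in auto)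
  then show "signof p * (\<Prod>j = 0..<d. f (p j) j) = 0" by simp
qed

lemma det_mat_last_column:
  fixes f :: "nat \<Rightarrow> nat \<Rightarrow> 'a :: comm_ring_1"
  assumes "\<And>i. i < d \<Longrightarrow> f i d = 0" "f d d = 1"
  shows "det (mat (Suc d) (Suc d) (\<lambda>(i, j). f i j)) = det (mat d d (\<lambda>(i, j). f i j))"
proof -
  let ?A = "mat (Suc d) (Suc d) (\<lambda>(i, j). f i j)"
  have "det ?A = (\<Sum>i<Suc d. ?A $$ (i, d) * cofactor ?A i d)"
    by (rule laplace_expansion_column) auto
  also have "\<dots> = cofactor ?A d d"
    using assms by simp
  also have "mat_delete ?A d d = mat d d (\<lambda>(i, j). f i j)"
    by (rule eq_matI) (auto simp: mat_delete_def)
  then have "cofactor ?A d d = det (mat d d (\<lambda>(i, j). f i j))"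
    by (simp add: cofactor_def)
  finally show ?thesis .
qed

text \<open>
  The last \<open>d - c\<close> rows are supported on the last \<open>d - c - 1\<close> columns, so by the pigeonhole principle
  every Leibniz term vanishes.
\<close>
lemma det_mat_zero_block:
  fixes f :: "nat \<Rightarrow> nat \<Rightarrow> 'a :: comm_ring_1"
  assumes "c < d" "\<And>i j. c \<le> i \<Longrightarrow> i < d \<Longrightarrow> j \<le> c \<Longrightarrow> f i j = 0"
  shows "det (mat d d (\<lambda>(i, j). f i j)) = 0"
  unfolding det_mat_eq_sum
proof (intro sum.neutral ballI)
  fix p assume "p \<in> {p. p permutes {0..<d}}"
  then have p: "p permutes {0..<d}" by simp
  have "\<exists>i\<in>{c..<d}. p i \<le> c"
  proof (rule ccontr)
    assume "\<not> ?thesis"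
    then have "p ` {c..<d} \<subseteq> {Suc c..<d}"
      using permutes_nat_less[OF p] by (auto simp: not_le Suc_le_eq)
    then have "card (p ` {c..<d}) \<le> card {Suc c..<d}"
      by (intro card_mono) auto
    moreover have "card (p ` {c..<d}) = d - c"
      using permutes_inj[OF p] by (simp add: card_image inj_on_def inj_def)
    ultimately show False using assms(1) by simp
  qed
  then obtain i where i: "c \<le> i" "i < d" "p i \<le> c" by auto
  then have "f i (p i) = 0" using assms(2) by blast
  then have "(\<Prod>i = 0..<d. f i (p i)) = 0"
    by (intro prod_zero) (use i in auto)
  then show "signof p * (\<Prod>i = 0..<d. f i (p i)) = 0" by simp
qed

lemma det_mat_unitriangular:
  fixes f :: "nat \<Rightarrow> nat \<Rightarrow> 'a :: comm_ring_1"
  assumes "\<And>i j. j < i \<Longrightarrow> i < d \<Longrightarrow> f i j = 0" "\<And>i. i < d \<Longrightarrow> f i i = 1"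
  shows "det (mat d d (\<lambda>(i, j). f i j)) = 1"
proof -
  have "upper_triangular (mat d d (\<lambda>(i, j). f i j))"
    using assms(1) by auto
  then have "det (mat d d (\<lambda>(i, j). f i j)) = prod_list (diag_mat (mat d d (\<lambda>(i, j). f i j)))"
    by (rule det_upper_triangular) auto
  also have "\<dots> = 1"
    unfolding prod_list_diag_prod using assms(2) by (simp add: prod.neutral)
  finally show ?thesis .
qed

lemma det_mat_mult:
  fixes f g :: "nat \<Rightarrow> nat \<Rightarrow> 'a :: comm_ring_1"
  shows "det (mat d d (\<lambda>(i, j). \<Sum>b<d. f i b * g b j)) =
    det (mat d d (\<lambda>(i, j). f i j)) * det (mat d d (\<lambda>(i, j). g i j))"
proof -
  have "mat d d (\<lambda>(i, j). \<Sum>b<d. f i b * g b j) =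
      mat d d (\<lambda>(i, j). f i j) * mat d d (\<lambda>(i, j). g i j)"
    by (rule eq_matI) (auto simp: scalar_prod_def atLeast0LessThan intro!: sum.cong)
  then show ?thesis by (simp add: det_mult[of _ d])
qed

section \<open>Standard tableaux as linear extensions\<close>

text \<open>
  For the relation ``left of in the same row or above in the same column'' these are the standard
  fillings of \<open>D\<close>.
\<close>
definition linear_extensions :: "('a \<Rightarrow> 'a \<Rightarrow> bool) \<Rightarrow> 'a set \<Rightarrow> ('a \<Rightarrow> nat) set" where
  "linear_extensions R D =
    {T \<in> extensional D. bij_betw T D {1..card D} \<and> (\<forall>u\<in>D. \<forall>v\<in>D. R u v \<longrightarrow> T u < T v)}"

lemma linear_extensions_empty: "linear_extensions R {} = {\<lambda>_. undefined}"
  by (auto simp: linear_extensions_def extensional_def bij_betw_def)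

lemma finite_linear_extensions:
  assumes "finite D"
  shows "finite (linear_extensions R D)"
proof (rule finite_subset)
  show "linear_extensions R D \<subseteq> D \<rightarrow>\<^sub>E {1..card D}"
    by (auto simp: linear_extensions_def PiE_def bij_betw_def)
qed (use assms in \<open>auto intro: finite_PiE\<close>)

lemma bij_betw_remove_top:
  assumes "finite D" "u \<in> D" "T u = card D"
  shows "bij_betw T (D - {u}) {1..card (D - {u})} \<longleftrightarrow> bij_betw T D {1..card D}"
proof -
  have D: "(D - {u}) \<union> {u} = D" "card D = Suc (card (D - {u}))"
    using assms card_Suc_Diff1[of D u] by auto
  have "bij_betw T (D - {u}) {1..card (D - {u})} \<longleftrightarrow>
      bij_betw T ((D - {u}) \<union> {u}) ({1..card (D - {u})} \<union> {T u})"
    by (rule notIn_Un_bij_betw3) (use assms(3) D(2) in auto)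
  also have "{1..card (D - {u})} \<union> {T u} = {1..card D}"
    unfolding assms(3) D(2) by auto
  finally show ?thesis unfolding D(1) .
qed

lemma card_linear_extensions_top:
  assumes "finite D" "u \<in> D" and max: "\<forall>v\<in>D. \<not> R u v"
  shows "card {T \<in> linear_extensions R D. T u = card D} = card (linear_extensions R (D - {u}))"
proof -
  have D: "card D = Suc (card (D - {u}))"
    using assms card_Suc_Diff1[of D u] by auto
  have "bij_betw (\<lambda>T. restrict T (D - {u})) {T \<in> linear_extensions R D. T u = card D}
      (linear_extensions R (D - {u}))"
  proof (rule bij_betw_byWitness[where f' = "\<lambda>T. T(u := card D)"])
    show "(\<lambda>T. restrict T (D - {u})) ` {T \<in> linear_extensions R D. T u = card D}
        \<subseteq> linear_extensions R (D - {u})"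
    proof (rule image_subsetI)
      fix T assume T: "T \<in> {T \<in> linear_extensions R D. T u = card D}"
      then have "bij_betw T (D - {u}) {1..card (D - {u})}"
        using bij_betw_remove_top[OF assms(1,2), of T] by (simp add: linear_extensions_def)
      then have "bij_betw (restrict T (D - {u})) (D - {u}) {1..card (D - {u})}"
        by (subst bij_betw_cong[of _ _ T]) auto
      then show "restrict T (D - {u}) \<in> linear_extensions R (D - {u})"
        using T by (simp add: linear_extensions_def)
    qed
    show "(\<lambda>T. T(u := card D)) ` linear_extensions R (D - {u})
        \<subseteq> {T \<in> linear_extensions R D. T u = card D}"
    proof (rule image_subsetI)
      fix T assume T: "T \<in> linear_extensions R (D - {u})"
      let ?T = "T(u := card D)"
      have "bij_betw T (D - {u}) {1..card (D - {u})}"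
        using T by (simp add: linear_extensions_def)
      then have "bij_betw ?T (D - {u}) {1..card (D - {u})}"
        by (subst bij_betw_cong[of _ _ T]) auto
      then have "bij_betw ?T D {1..card D}"
        using bij_betw_remove_top[OF assms(1,2), of ?T] by simp
      moreover have "?T x < ?T y" if "x \<in> D" "y \<in> D" "R x y" for x y
      proof -
        have "x \<noteq> u" using that max by auto
        moreover have "T x < card D" if "x \<in> D - {u}"
        proof -
          have "T x \<in> {1..card (D - {u})}"
            using T that by (auto simp: linear_extensions_def dest: bij_betwE)
          then show ?thesis using D by simp
        qed
        ultimately show ?thesis
          using T that by (auto simp: linear_extensions_def)
      qed
      moreover have "?T \<in> extensional D"
        using T assms(2) by (auto simp: linear_extensions_def extensional_def)
      ultimately show "?T \<in> {T \<in> linear_extensions R D. T u = card D}"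
        by (simp add: linear_extensions_def)
    qed
    show "\<forall>T\<in>{T \<in> linear_extensions R D. T u = card D}. (restrict T (D - {u}))(u := card D) = T"
      by (auto simp: linear_extensions_def extensional_def fun_eq_iff)
    show "\<forall>T\<in>linear_extensions R (D - {u}). restrict (T(u := card D)) (D - {u}) = T"
      by (auto simp: linear_extensions_def extensional_def fun_eq_iff)
  qed
  then show ?thesis by (rule bij_betw_same_card)
qed

text \<open>
  The largest label sits at some element without successors; removing it leaves a linear extension of
  the rest, and it can be put back in exactly one way.
\<close>
lemma card_linear_extensions_rec:
  assumes "finite D" "D \<noteq> {}"
  shows "card (linear_extensions R D) =
    (\<Sum>u | u \<in> D \<and> (\<forall>v\<in>D. \<not> R u v). card (linear_extensions R (D - {u})))"
proof -
  let ?M = "{u \<in> D. \<forall>v\<in>D. \<not> R u v}"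
  let ?L = "\<lambda>u. {T \<in> linear_extensions R D. T u = card D}"
  have "linear_extensions R D = (\<Union>u\<in>?M. ?L u)"
  proof (intro equalityI subsetI)
    fix T assume T: "T \<in> linear_extensions R D"
    then have bij: "bij_betw T D {1..card D}"
      and mono: "\<And>x y. x \<in> D \<Longrightarrow> y \<in> D \<Longrightarrow> R x y \<Longrightarrow> T x < T y"
      by (auto simp: linear_extensions_def)
    have "1 \<le> card D" using assms by (simp add: Suc_le_eq card_gt_0_iff)
    then have "card D \<in> T ` D"
      using bij by (simp add: bij_betw_def)
    then obtain u where u: "u \<in> D" "T u = card D" by force
    have "T v \<le> card D" if "v \<in> D" for v
      using bij that by (auto simp: bij_betw_def)
    then have "\<forall>v\<in>D. \<not> R u v"
      using mono[OF u(1)] u(2) by (metis leD)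
    then show "T \<in> (\<Union>u\<in>?M. ?L u)" using T u by blast
  qed auto
  moreover have "card (\<Union>u\<in>?M. ?L u) = (\<Sum>u\<in>?M. card (?L u))"
  proof (rule card_UN_disjoint)
    show "\<forall>u\<in>?M. \<forall>v\<in>?M. u \<noteq> v \<longrightarrow> ?L u \<inter> ?L v = {}"
    proof (intro ballI impI)
      fix u v assume uv: "u \<in> ?M" "v \<in> ?M" "u \<noteq> v"
      have "u = v" if T: "T \<in> ?L u" "T \<in> ?L v" for T
      proof (rule inj_onD[of T D])
        show "inj_on T D"
          using T by (simp add: linear_extensions_def bij_betw_def)
      qed (use uv T in auto)
      then show "?L u \<inter> ?L v = {}" using uv(3) by blast
    qed
  qed (use assms in \<open>auto simp: finite_linear_extensions\<close>)
  moreover have "card (?L u) = card (linear_extensions R (D - {u}))" if "u \<in> ?M" for u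
    using that assms(1) by (intro card_linear_extensions_top) auto
  ultimately show ?thesis by simp
qed

section \<open>Skew shapes and their removable corners\<close>

lemma antimono_on_below_iff:
  "antimono_on {..<d} f \<longleftrightarrow> (\<forall>i j. i \<le> j \<longrightarrow> j < d \<longrightarrow> f j \<le> f i)"
  for f :: "nat \<Rightarrow> nat"
  by (auto simp: monotone_on_def)

lemma antimono_on_belowD:
  "antimono_on {..<d} f \<Longrightarrow> i \<le> j \<Longrightarrow> j < d \<Longrightarrow> f j \<le> f i"
  for f :: "nat \<Rightarrow> nat"
  by (simp add: antimono_on_below_iff)

definition row_or_column_before :: "nat \<times> nat \<Rightarrow> nat \<times> nat \<Rightarrow> bool" where
  "row_or_column_before u v \<longleftrightarrow>
    fst u = fst v \<and> snd u < snd v \<or> snd u = snd v \<and> fst u < fst v"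

text \<open>
  Rows and columns of cells are numbered from 1, as in diagrams of partitions, whereas row lengths are
  indexed from 0, as the rows of matrices.
\<close>
definition skew_cells :: "nat \<Rightarrow> (nat \<Rightarrow> nat) \<Rightarrow> (nat \<Rightarrow> nat) \<Rightarrow> (nat \<times> nat) set" where
  "skew_cells d la mu = {(i, j). 1 \<le> i \<and> i \<le> d \<and> mu (i - 1) < j \<and> j \<le> la (i - 1)}"

lemma skew_cells_eq_Union:
  "skew_cells d la mu = (\<Union>i<d. {Suc i} \<times> {mu i<..la i})"
proof (intro equalityI subsetI)
  fix c assume "c \<in> skew_cells d la mu"
  then show "c \<in> (\<Union>i<d. {Suc i} \<times> {mu i<..la i})"
    by (intro UN_I[of "fst c - 1"]) (auto simp: skew_cells_def)
qed (auto simp: skew_cells_def)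

lemma finite_skew_cells: "finite (skew_cells d la mu)"
  unfolding skew_cells_eq_Union by auto

text \<open>
  The places that the largest label can take: the removable corners of the outer shape outside the
  inner one.
\<close>
lemma maximal_skew_cells:
  assumes la: "antimono_on {..<d} la" and mu: "antimono_on {..<d} mu"
  shows "{u \<in> skew_cells d la mu. \<forall>v\<in>skew_cells d la mu. \<not> row_or_column_before u v} =
    (\<lambda>i. (Suc i, la i)) ` {i. i < d \<and> mu i < la i \<and> (Suc i < d \<longrightarrow> la (Suc i) < la i)}"
    (is "?M = ?f ` ?I")
proof (intro equalityI subsetI)
  fix u assume "u \<in> ?M"
  then have "u \<in> skew_cells d la mu"
    and max: "\<And>v. v \<in> skew_cells d la mu \<Longrightarrow> \<not> row_or_column_before u v"
    by auto
  then obtain i j where u: "u = (Suc i, j)" and i: "i < d" "mu i < j" "j \<le> la i"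
    by (auto simp: skew_cells_eq_Union)
  have "\<not> j < la i"
  proof
    assume "j < la i"
    then have "(Suc i, Suc j) \<in> skew_cells d la mu"
      using i by (auto simp: skew_cells_def)
    then show False
      using max[of "(Suc i, Suc j)"] u by (simp add: row_or_column_before_def)
  qed
  then have j: "j = la i" using i(3) by linarith
  have "la (Suc i) < la i" if "Suc i < d"
  proof (rule ccontr)
    assume "\<not> ?thesis"
    moreover have "mu (Suc i) \<le> mu i" using antimono_on_belowD[OF mu] that by simp
    ultimately have "(Suc (Suc i), la i) \<in> skew_cells d la mu"
      using that i j by (auto simp: skew_cells_def)
    then show False
      using max[of "(Suc (Suc i), la i)"] j u by (simp add: row_or_column_before_def)
  qed
  then show "u \<in> ?f ` ?I" using u i j by auto
next
  fix u assume "u \<in> ?f ` ?I"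
  then obtain i where u: "u = (Suc i, la i)" and i: "i < d" "mu i < la i"
    and corner: "Suc i < d \<Longrightarrow> la (Suc i) < la i" by auto
  have "\<not> row_or_column_before u v" if v: "v \<in> skew_cells d la mu" for v
  proof
    assume "row_or_column_before u v"
    moreover obtain h where h: "fst v = Suc h" "h < d" "snd v \<le> la h"
      using v by (auto simp: skew_cells_eq_Union)
    ultimately have "i < h" "la i \<le> la h" using u by (auto simp: row_or_column_before_def)
    then show False
      using corner antimono_on_belowD[OF la, of "Suc i" h] h by simp
  qed
  then show "u \<in> ?M" using u i by (auto simp: skew_cells_def)
qed

section \<open>Aitken's determinant for skew standard tableaux\<close>

definition inv_fact_diff :: "nat \<Rightarrow> nat \<Rightarrow> real" where
  "inv_fact_diff r s = (if s \<le> r then 1 / fact (r - s) else 0)"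

text \<open>
  Used with the shifted parts \<open>r\<^sub>i = la\<^sub>i + d - i\<close> and \<open>s\<^sub>j = mu\<^sub>j + d - j\<close>, for which the entries are the
  usual \<open>1 / (la\<^sub>i - i - mu\<^sub>j + j)!\<close> while all arguments stay natural numbers.
\<close>
definition aitken :: "nat \<Rightarrow> (nat \<Rightarrow> nat) \<Rightarrow> (nat \<Rightarrow> nat) \<Rightarrow> real" where
  "aitken d r s = det (mat d d (\<lambda>(i, j). inv_fact_diff (r i) (s j)))"

text \<open>
  The hypothesis makes truncated subtraction harmless: for \<open>r = 0\<close> both sides vanish.
\<close>
lemma inv_fact_diff_pred:
  assumes "1 \<le> s"
  shows "inv_fact_diff (r - 1) s = (real r - real s) * inv_fact_diff r s"
proof (cases "s < r")
  case True
  then obtain k where k: "r = s + Suc k" using less_imp_Suc_add by auto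
  show ?thesis using k by (simp add: inv_fact_diff_def fact_Suc del: of_nat_Suc) simp
qed (use assms in \<open>auto simp: inv_fact_diff_def\<close>)

text \<open>
  Lowering \<open>r\<^sub>i\<close> multiplies the Leibniz term of a permutation \<open>p\<close> by \<open>r\<^sub>i - s\<^sub>p\<^sub>(\<^sub>i\<^sub>)\<close>, and the sum of these
  factors over \<open>i\<close> does not depend on \<open>p\<close>.
\<close>
lemma aitken_sum_pred:
  assumes "\<And>j. j < d \<Longrightarrow> 1 \<le> s j"
  shows "(\<Sum>i<d. aitken d (r(i := r i - 1)) s) =
    (real (\<Sum>i<d. r i) - real (\<Sum>j<d. s j)) * aitken d r s"
proof -
  have "(\<Sum>i<d. \<Prod>h = 0..<d. inv_fact_diff ((r(i := r i - 1)) h) (s (p h))) =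
      (real (\<Sum>i<d. r i) - real (\<Sum>j<d. s j)) * (\<Prod>h = 0..<d. inv_fact_diff (r h) (s (p h)))"
    if p: "p permutes {0..<d}" for p
  proof -
    have "(\<Prod>h = 0..<d. inv_fact_diff ((r(i := r i - 1)) h) (s (p h))) =
        (real (r i) - real (s (p i))) * (\<Prod>h = 0..<d. inv_fact_diff (r h) (s (p h)))" if "i < d" for i
    proof -
      have i: "i \<in> {0..<d}" using that by simp
      have "1 \<le> s (p i)" using assms permutes_nat_less[OF p that] by blast
      then show ?thesis
        unfolding prod.remove[OF finite_atLeastLessThan i]
        using inv_fact_diff_pred[of "s (p i)" "r i"] by simp
    qed
    moreover have "(\<Sum>i<d. real (s (p i))) = (\<Sum>j<d. real (s j))"
      using sum.permute[OF p, of "\<lambda>j. real (s j)"] by (simp add: o_def atLeast0LessThan)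
    ultimately show ?thesis
      by (simp add: sum_distrib_right[symmetric] sum_subtractf)
  qed
  then have "(\<Sum>p | p permutes {0..<d}. signof p *
        (\<Sum>i<d. \<Prod>h = 0..<d. inv_fact_diff ((r(i := r i - 1)) h) (s (p h)))) =
      (\<Sum>p | p permutes {0..<d}. (real (\<Sum>i<d. r i) - real (\<Sum>j<d. s j)) *
        (signof p * (\<Prod>h = 0..<d. inv_fact_diff (r h) (s (p h)))))"
    by (intro sum.cong refl) (simp only: mem_Collect_eq mult.left_commute)
  then show ?thesis
    unfolding aitken_def det_mat_eq_sum
    by (subst sum.swap) (simp only: sum_distrib_left)
qed

lemma aitken_self:
  assumes "\<And>i j. i < j \<Longrightarrow> j < d \<Longrightarrow> r j < r i" "\<And>i. i < d \<Longrightarrow> s i = r i"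
  shows "aitken d r s = 1"
  unfolding aitken_def
  by (rule det_mat_unitriangular) (use assms in \<open>fastforce simp: inv_fact_diff_def\<close>)+

lemma aitken_collision:
  assumes "i \<noteq> i'" "i < d" "i' < d" "r i = r i'"
  shows "aitken d r s = 0"
  unfolding aitken_def by (rule det_mat_equal_rows[of i i']) (use assms in auto)

lemma aitken_not_above:
  assumes "antimono_on {..<d} r" "antimono_on {..<d} s" "c < d" "r c < s c"
  shows "aitken d r s = 0"
  unfolding aitken_def
proof (rule det_mat_zero_block[OF assms(3)])
  fix i j assume "c \<le> i" "i < d" "j \<le> c"
  then have "r i < s j"
    using antimono_on_belowD[OF assms(1), of c i] antimono_on_belowD[OF assms(2), of j c] assms(3,4) by simp
  then show "inv_fact_diff (r i) (s j) = 0" by (simp add: inv_fact_diff_def)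
qed

text \<open>
  Induction on the outer shape. The removable corners match those terms of the recursion
  \<open>aitken_sum_pred\<close> that survive: lowering any other row either makes two shifted parts equal, or takes
  the outer row below the inner one, and the determinant is zero in both cases.
\<close>
theorem aitken_formula:
  assumes "antimono_on {..<d} la" "antimono_on {..<d} mu" "\<And>i. i < d \<Longrightarrow> mu i \<le> la i"
  shows "real (card (linear_extensions row_or_column_before (skew_cells d la mu))) =
    fact ((\<Sum>i<d. la i) - (\<Sum>i<d. mu i)) *
      aitken d (\<lambda>i. la i + (d - i)) (\<lambda>i. mu i + (d - i))"
  using assms(1,3)
proof (induction "\<Sum>i<d. la i" arbitrary: la rule: less_induct)
  case less
  note la = antimono_on_belowD[OF less.prems(1)] and mu = antimono_on_belowD[OF assms(2)]
  let ?D = "skew_cells d la mu" and ?R = row_or_column_before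
  let ?N = "(\<Sum>i<d. la i) - (\<Sum>i<d. mu i)"
  let ?r = "\<lambda>i. la i + (d - i)" and ?s = "\<lambda>i. mu i + (d - i)"
  have le: "(\<Sum>i<d. mu i) \<le> (\<Sum>i<d. la i)"
    by (intro sum_mono) (use less.prems(2) in auto)
  show ?case
  proof (cases "\<forall>i<d. la i = mu i")
    case True
    then have "?D = {}" by (auto simp: skew_cells_eq_Union)
    moreover have "aitken d ?r ?s = 1"
    proof (rule aitken_self)
      show "?r j < ?r i" if "i < j" "j < d" for i j
        using la[of i j] that by simp
    qed (use True in auto)
    ultimately show ?thesis using True by (simp add: linear_extensions_empty)
  next
    case False
    then obtain i0 where i0: "i0 < d" "mu i0 < la i0"
      using less.prems(2) by (metis le_neq_implies_less)
    have N: "?N = Suc (?N - 1)"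
    proof -
      have "(\<Sum>i<d. mu i) < (\<Sum>i<d. la i)"
        by (rule sum_strict_mono_ex1) (use less.prems(2) i0 in auto)
      then show ?thesis by simp
    qed
    define I where "I = {i. i < d \<and> mu i < la i \<and> (Suc i < d \<longrightarrow> la (Suc i) < la i)}"
    have IH: "real (card (linear_extensions ?R (?D - {(Suc i, la i)}))) =
        fact (?N - 1) * aitken d (?r(i := ?r i - 1)) ?s" if "i \<in> I" for i
    proof -
      have i: "i < d" "mu i < la i" "Suc i < d \<Longrightarrow> la (Suc i) < la i"
        using that by (auto simp: I_def)
      let ?la = "la(i := la i - 1)"
      have D: "?D - {(Suc i, la i)} = skew_cells d ?la mu"
        using i unfolding skew_cells_eq_Union
        by (auto split: if_splits)
      have sum: "(\<Sum>h<d. ?la h) = (\<Sum>h<d. la h) - 1"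
      proof -
        have "i \<in> {..<d}" using i by simp
        then show ?thesis
          unfolding sum.remove[OF finite_lessThan \<open>i \<in> {..<d}\<close>] using i by simp
      qed
      have r: "(\<lambda>h. ?la h + (d - h)) = ?r(i := ?r i - 1)"
        using i by auto
      have anti: "antimono_on {..<d} ?la"
        unfolding antimono_on_below_iff
      proof (intro allI impI)
        fix a b assume ab: "a \<le> b" "b < d"
        have "la b < la i" if "a = i" "b \<noteq> i"
          using la[of "Suc i" b] i(3) that ab by simp
        then show "?la b \<le> ?la a" using la[of a b] ab by auto
      qed
      have fewer: "(\<Sum>h<d. ?la h) < (\<Sum>h<d. la h)"
        unfolding sum using N by linarith
      have above: "mu h \<le> ?la h" if "h < d" for h
        using less.prems(2)[OF that] i(2) by (cases "h = i") auto
      have "real (card (linear_extensions ?R (skew_cells d ?la mu))) =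
          fact ((\<Sum>h<d. ?la h) - (\<Sum>h<d. mu h)) * aitken d (\<lambda>h. ?la h + (d - h)) ?s"
        by (rule less.hyps[OF fewer anti above])
      then show ?thesis unfolding D sum r by (simp add: diff_commute)
    qed
    have zero: "aitken d (?r(i := ?r i - 1)) ?s = 0" if i: "i < d" "i \<notin> I" for i
    proof -
      consider "la i \<le> mu i" | "Suc i < d" "la i \<le> la (Suc i)"
        using i unfolding I_def by (auto simp: not_less)
      then show ?thesis
      proof cases
        case 1
        show ?thesis
        proof (rule aitken_not_above[of _ _ _ i])
          show "antimono_on {..<d} (?r(i := ?r i - 1))"
            unfolding antimono_on_below_iff
          proof (intro allI impI)
            fix a b assume ab: "a \<le> b" "b < d"
            show "(?r(i := ?r i - 1)) b \<le> (?r(i := ?r i - 1)) a"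
              using la[of a b] ab by (cases "a = b") (auto simp: le_diff_conv2)
          qed
          show "antimono_on {..<d} ?s"
            unfolding antimono_on_below_iff by (intro allI impI add_mono mu diff_le_mono2)
          show "(?r(i := ?r i - 1)) i < ?s i" using 1 i(1) by simp
        qed (rule i(1))
      next
        case 2
        then have "la (Suc i) = la i" using la[of i "Suc i"] by simp
        then show ?thesis
          by (intro aitken_collision[of i "Suc i"]) (use 2 i in auto)
      qed
    qed
    have nonempty: "?D \<noteq> {}" using i0 by (auto simp: skew_cells_eq_Union)
    have "card (linear_extensions ?R ?D) =
        (\<Sum>u\<in>(\<lambda>i. (Suc i, la i)) ` I. card (linear_extensions ?R (?D - {u})))"
      unfolding card_linear_extensions_rec[OF finite_skew_cells nonempty] I_def
        maximal_skew_cells[OF less.prems(1) assms(2), symmetric] ..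
    also have "\<dots> = (\<Sum>i\<in>I. card (linear_extensions ?R (?D - {(Suc i, la i)})))"
      by (subst sum.reindex) (auto simp: inj_on_def)
    finally have "real (card (linear_extensions ?R ?D)) =
        (\<Sum>i\<in>I. real (card (linear_extensions ?R (?D - {(Suc i, la i)}))))"
      by simp
    also have "\<dots> = (\<Sum>i\<in>I. fact (?N - 1) * aitken d (?r(i := ?r i - 1)) ?s)"
      by (intro sum.cong refl IH)
    also have "\<dots> = fact (?N - 1) * (\<Sum>i<d. aitken d (?r(i := ?r i - 1)) ?s)"
      unfolding sum_distrib_left using zero by (intro sum.mono_neutral_left) (auto simp: I_def)
    also have "(\<Sum>i<d. aitken d (?r(i := ?r i - 1)) ?s) =
        (real (\<Sum>i<d. ?r i) - real (\<Sum>i<d. ?s i)) * aitken d ?r ?s"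
      by (rule aitken_sum_pred) simp
    also have "real (\<Sum>i<d. ?r i) - real (\<Sum>i<d. ?s i) = real ?N"
      by (simp only: of_nat_diff[OF le] sum.distrib of_nat_add)
    also have "fact (?N - 1) * (real ?N * aitken d ?r ?s) = fact ?N * aitken d ?r ?s"
    proof -
      have "0 < ?N" using N by linarith
      then have "(fact ?N :: real) = real ?N * fact (?N - 1)" by (rule fact_reduce)
      then show ?thesis by (simp only: mult_ac)
    qed
    finally show ?thesis .
  qed
qed

section \<open>Flagged tableaux, column by column\<close>

text \<open>
  Here \<open>m j\<close> is the length of the column with number \<open>j + 1\<close>.
\<close>
definition column_cells :: "nat \<Rightarrow> (nat \<Rightarrow> nat) \<Rightarrow> (nat \<times> nat) set" where
  "column_cells d m = {(i, j). 1 \<le> i \<and> 1 \<le> j \<and> j \<le> d \<and> i \<le> m (j - 1)}"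

text \<open>
  The last condition is the form that \<open>c(u) < \<lambda>\<^sub>(\<^sub>d\<^sub>+\<^sub>1\<^sub>-\<^sub>T\<^sub>(\<^sub>u\<^sub>)\<^sub>)\<close> takes for the staircase \<open>\<lambda>\<close> with \<open>d\<close>
  parts, where \<open>\<lambda>\<^sub>(\<^sub>d\<^sub>+\<^sub>1\<^sub>-\<^sub>t\<^sub>) = t\<close>.
\<close>
definition flagged_tableaux :: "nat \<Rightarrow> (nat \<Rightarrow> nat) \<Rightarrow> (nat \<times> nat \<Rightarrow> nat) set" where
  "flagged_tableaux d m =
    {T \<in> column_cells d m \<rightarrow>\<^sub>E {1..d}.
      (\<forall>i j j'. (i, j) \<in> column_cells d m \<longrightarrow> (i, j') \<in> column_cells d m \<longrightarrow> j < j' \<longrightarrow>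
        T (i, j) \<le> T (i, j')) \<and>
      (\<forall>i i' j. (i, j) \<in> column_cells d m \<longrightarrow> (i', j) \<in> column_cells d m \<longrightarrow> i < i' \<longrightarrow>
        T (i, j) < T (i', j)) \<and>
      (\<forall>(i, j) \<in> column_cells d m. j < T (i, j) + i)}"

definition shorten :: "nat set \<Rightarrow> (nat \<Rightarrow> nat) \<Rightarrow> nat \<Rightarrow> nat" where
  "shorten E m j = m j - of_bool (j \<in> E)"

text \<open>
  The sets of columns from which a bottom cell can be removed so that at most \<open>d\<close> columns, again of
  weakly decreasing lengths, remain. The comparison is made in the integers so that a column of length 0
  cannot be shortened: its length would drop below that of the last column, which becomes 0.
\<close>
definition vertical_strips :: "nat \<Rightarrow> (nat \<Rightarrow> nat) \<Rightarrow> nat set set" where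
  "vertical_strips d m = {E \<in> Pow {..<Suc d}. m d = of_bool (d \<in> E) \<and>
    (\<forall>i j. i \<le> j \<longrightarrow> j \<le> d \<longrightarrow> int (m j) - of_bool (j \<in> E) \<le> int (m i) - of_bool (i \<in> E))}"

text \<open>
  Columns increase strictly, so the bottom cell is the only place where \<open>d + 1\<close> can stand.
\<close>
definition top_columns :: "nat \<Rightarrow> (nat \<Rightarrow> nat) \<Rightarrow> (nat \<times> nat \<Rightarrow> nat) \<Rightarrow> nat set" where
  "top_columns d m T = {j. j \<le> d \<and> 0 < m j \<and> T (m j, Suc j) = Suc d}"

lemma vertical_stripD:
  assumes "E \<in> vertical_strips d m"
  shows "m d = of_bool (d \<in> E)" "j \<in> E \<Longrightarrow> j \<le> d"
    "i \<le> j \<Longrightarrow> j \<le> d \<Longrightarrow> int (m j) - of_bool (j \<in> E) \<le> int (m i) - of_bool (i \<in> E)"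
  using assms by (auto simp: vertical_strips_def)

lemma finite_column_cells: "finite (column_cells d m)"
proof -
  have "column_cells d m = (\<Union>j<d. {1..m j} \<times> {Suc j})"
  proof (intro equalityI subsetI)
    fix c assume "c \<in> column_cells d m"
    then show "c \<in> (\<Union>j<d. {1..m j} \<times> {Suc j})"
      by (intro UN_I[of "snd c - 1"]) (auto simp: column_cells_def)
  qed (auto simp: column_cells_def)
  then show ?thesis by simp
qed

lemma finite_flagged_tableaux: "finite (flagged_tableaux d m)"
  by (rule finite_subset[of _ "column_cells d m \<rightarrow>\<^sub>E {1..d}"])
    (auto simp: flagged_tableaux_def finite_column_cells intro!: finite_PiE)

lemma flagged_tableauxD:
  assumes "T \<in> flagged_tableaux d m"
  shows "c \<in> column_cells d m \<Longrightarrow> 1 \<le> T c" "c \<in> column_cells d m \<Longrightarrow> T c \<le> d"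
    "c \<notin> column_cells d m \<Longrightarrow> T c = undefined"
    "(i, j) \<in> column_cells d m \<Longrightarrow> (i, j') \<in> column_cells d m \<Longrightarrow> j \<le> j' \<Longrightarrow> T (i, j) \<le> T (i, j')"
    "(i, j) \<in> column_cells d m \<Longrightarrow> (i', j) \<in> column_cells d m \<Longrightarrow> i < i' \<Longrightarrow> T (i, j) < T (i', j)"
    "(i, j) \<in> column_cells d m \<Longrightarrow> j < T (i, j) + i"
proof -
  have T: "T \<in> column_cells d m \<rightarrow>\<^sub>E {1..d}"
    using assms by (simp add: flagged_tableaux_def)
  show "c \<in> column_cells d m \<Longrightarrow> 1 \<le> T c" "c \<in> column_cells d m \<Longrightarrow> T c \<le> d"
    using PiE_mem[OF T, of c] by auto
  show "c \<notin> column_cells d m \<Longrightarrow> T c = undefined"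
    using PiE_arb[OF T] by blast
qed (use assms in \<open>auto simp: flagged_tableaux_def le_less\<close>)

context
  fixes d :: nat and m :: "nat \<Rightarrow> nat"
  assumes m: "antimono_on {..<Suc d} m"
begin

lemma top_entry_iff:
  assumes T: "T \<in> flagged_tableaux (Suc d) m" and c: "(i, Suc j) \<in> column_cells (Suc d) m"
  shows "T (i, Suc j) = Suc d \<longleftrightarrow> j \<in> top_columns d m T \<and> i = m j"
proof
  assume top: "T (i, Suc j) = Suc d"
  have ij: "1 \<le> i" "j \<le> d" "i \<le> m j" using c by (auto simp: column_cells_def)
  then have c': "(m j, Suc j) \<in> column_cells (Suc d) m" by (auto simp: column_cells_def)
  have "\<not> i < m j"
    using flagged_tableauxD(5)[OF T c c'] flagged_tableauxD(2)[OF T c'] top by auto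
  then show "j \<in> top_columns d m T \<and> i = m j"
    using ij top by (auto simp: top_columns_def)
qed (simp add: top_columns_def)

text \<open>
  Weakly increasing rows pass the entry \<open>d + 1\<close> on to the next column of the same length. In the column
  with number \<open>d + 1\<close> the flag condition forces every entry to be \<open>d + 1\<close>, hence at most one cell; this
  is why the remaining tableau has only \<open>d\<close> columns.
\<close>
lemma top_columns_in_vertical_strips:
  assumes T: "T \<in> flagged_tableaux (Suc d) m"
  shows "top_columns d m T \<in> vertical_strips d m"
  unfolding vertical_strips_def
proof (intro CollectI conjI allI impI)
  show "top_columns d m T \<in> Pow {..<Suc d}" by (auto simp: top_columns_def)
  show "m d = of_bool (d \<in> top_columns d m T)"
  proof (cases "m d = 0")
    case False
    then have c: "(1, Suc d) \<in> column_cells (Suc d) m" "(m d, Suc d) \<in> column_cells (Suc d) m"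
      by (auto simp: column_cells_def)
    have "T (1, Suc d) = Suc d"
      using flagged_tableauxD(2,6)[OF T] c(1) by (metis Suc_eq_plus1 less_Suc_eq_le order_antisym)
    then show ?thesis using top_entry_iff[OF T c(1)] by auto
  qed (simp add: top_columns_def)
  show "int (m j) - of_bool (j \<in> top_columns d m T) \<le> int (m i) - of_bool (i \<in> top_columns d m T)"
    if ij: "i \<le> j" "j \<le> d" for i j
  proof (cases "m j = m i \<and> i \<in> top_columns d m T")
    case True
    then have c: "(m i, Suc i) \<in> column_cells (Suc d) m" "(m i, Suc j) \<in> column_cells (Suc d) m"
      using ij by (auto simp: column_cells_def top_columns_def)
    have "Suc d \<le> T (m i, Suc j)"
      using flagged_tableauxD(4)[OF T c] ij True by (simp add: top_columns_def)
    then have "j \<in> top_columns d m T"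
      using flagged_tableauxD(2)[OF T c(2)] top_entry_iff[OF T c(2)] by simp
    then show ?thesis using True by simp
  next
    case False
    then show ?thesis using antimono_on_belowD[OF m, of i j] ij by auto
  qed
qed

lemma column_cells_shorten:
  assumes E: "E \<in> vertical_strips d m"
  shows "(i, j) \<in> column_cells d (shorten E m) \<longleftrightarrow>
    (i, j) \<in> column_cells (Suc d) m \<and> \<not> (j - 1 \<in> E \<and> i = m (j - 1))"
proof -
  have "m d = of_bool (d \<in> E)" using E by (simp add: vertical_strips_def)
  moreover have "j \<le> d \<longleftrightarrow> j \<noteq> Suc d \<and> j \<le> Suc d" by auto
  ultimately show ?thesis
    by (cases "j = Suc d") (auto simp: column_cells_def shorten_def of_bool_def split: if_splits)
qed

lemma column_cells_shorten_mono:
  assumes E: "E \<in> vertical_strips d m"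
    and c: "(i', j') \<in> column_cells d (shorten E m)" "1 \<le> i" "i \<le> i'" "1 \<le> j" "j \<le> j'"
  shows "(i, j) \<in> column_cells d (shorten E m)"
proof -
  have "int (m (j' - 1)) - of_bool (j' - 1 \<in> E) \<le> int (m (j - 1)) - of_bool (j - 1 \<in> E)"
    using c by (intro vertical_stripD(3)[OF E]) (auto simp: column_cells_def)
  then show ?thesis
    using c by (auto simp: column_cells_def shorten_def of_bool_def split: if_splits)
qed

lemma vertical_strip_cell:
  assumes E: "E \<in> vertical_strips d m" and "j \<in> E"
  shows "1 \<le> m j" "j \<le> d"
proof -
  show "j \<le> d" by (rule vertical_stripD(2)[OF assms])
  then have "int (m d) - of_bool (d \<in> E) \<le> int (m j) - of_bool (j \<in> E)"
    by (intro vertical_stripD(3)[OF E]) auto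
  then show "1 \<le> m j" using \<open>j \<in> E\<close> vertical_stripD(1)[OF E] by simp
qed

lemma restrict_flagged_tableau:
  assumes T: "T \<in> flagged_tableaux (Suc d) m" and E: "E = top_columns d m T"
  shows "restrict T (column_cells d (shorten E m)) \<in> flagged_tableaux d (shorten E m)"
proof -
  have strip: "E \<in> vertical_strips d m"
    unfolding E by (rule top_columns_in_vertical_strips[OF T])
  have sub: "c \<in> column_cells (Suc d) m" if "c \<in> column_cells d (shorten E m)" for c
    using that column_cells_shorten[OF strip] by (cases c) auto
  have "T c \<le> d" if c: "c \<in> column_cells d (shorten E m)" for c
  proof -
    obtain i j where ij: "c = (i, Suc j)"
      using c by (cases c, cases "snd c") (auto simp: column_cells_def)
    have "T c \<noteq> Suc d"
      using top_entry_iff[OF T, of i j] sub[OF c] c column_cells_shorten[OF strip, of i "Suc j"]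
      unfolding ij E by auto
    then show ?thesis using flagged_tableauxD(2)[OF T sub[OF c]] by simp
  qed
  then show ?thesis
    unfolding flagged_tableaux_def
    using sub flagged_tableauxD(1)[OF T] flagged_tableauxD(4-6)[OF T] by auto
qed

definition add_top :: "nat set \<Rightarrow> (nat \<times> nat \<Rightarrow> nat) \<Rightarrow> nat \<times> nat \<Rightarrow> nat" where
  "add_top E T = (\<lambda>c\<in>column_cells (Suc d) m. if c \<in> column_cells d (shorten E m) then T c else Suc d)"

text \<open>
  The new bottom cells satisfy the flag condition automatically, as their columns have number at most
  \<open>d + 1\<close> and their rows have number at least 1.
\<close>
lemma add_top_flagged_tableau:
  assumes E: "E \<in> vertical_strips d m" and T: "T \<in> flagged_tableaux d (shorten E m)"
  shows "add_top E T \<in> flagged_tableaux (Suc d) m"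
proof -
  let ?C = "column_cells (Suc d) m" and ?C' = "column_cells d (shorten E m)"
  let ?T = "\<lambda>c. if c \<in> ?C' then T c else Suc d"
  have val: "?T c \<in> {1..Suc d}" for c
    using flagged_tableauxD(1,2)[OF T, of c] by auto
  have row: "?T (i, j) \<le> ?T (i, j')" if "(i, j) \<in> ?C" "(i, j') \<in> ?C" "j < j'" for i j j'
  proof (cases "(i, j') \<in> ?C'")
    case True
    then have "(i, j) \<in> ?C'"
      using column_cells_shorten_mono[OF E True, of i j] that by (auto simp: column_cells_def)
    then show ?thesis using flagged_tableauxD(4)[OF T _ True] that True by simp
  next
    case False
    then show ?thesis using val[of "(i, j)"] by simp
  qed
  have col: "?T (i, j) < ?T (i', j)" if "(i, j) \<in> ?C" "(i', j) \<in> ?C" "i < i'" for i i' j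
  proof (cases "(i', j) \<in> ?C'")
    case True
    then have "(i, j) \<in> ?C'"
      using column_cells_shorten_mono[OF E True, of i j] that by (auto simp: column_cells_def)
    then show ?thesis using flagged_tableauxD(5)[OF T _ True] that True by simp
  next
    case False
    then have "i' = m (j - 1)" using column_cells_shorten[OF E] that by auto
    then have "(i, j) \<in> ?C'" using column_cells_shorten[OF E] that by auto
    then show ?thesis using False flagged_tableauxD(2)[OF T] by (simp add: less_Suc_eq_le)
  qed
  have flag: "j < ?T (i, j) + i" if "(i, j) \<in> ?C" for i j
    using that flagged_tableauxD(6)[OF T, of i j] by (auto simp: column_cells_def)
  show ?thesis
    unfolding add_top_def flagged_tableaux_def
    using val row col flag by (auto simp del: atLeastAtMost_iff)
qed

lemma top_columns_add_top:
  assumes E: "E \<in> vertical_strips d m" and T: "T \<in> flagged_tableaux d (shorten E m)"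
  shows "top_columns d m (add_top E T) = E"
proof -
  have "j \<in> top_columns d m (add_top E T) \<longleftrightarrow> j \<in> E" for j
  proof (cases "j \<le> d \<and> 0 < m j")
    case True
    then have c: "(m j, Suc j) \<in> column_cells (Suc d) m" by (auto simp: column_cells_def)
    have "T (m j, Suc j) \<le> d" if "(m j, Suc j) \<in> column_cells d (shorten E m)"
      using flagged_tableauxD(2)[OF T that] .
    then show ?thesis
      using True c column_cells_shorten[OF E, of "m j" "Suc j"]
      by (auto simp: top_columns_def add_top_def)
  next
    case False
    then show ?thesis
      using vertical_strip_cell[OF E, of j] by (auto simp: top_columns_def)
  qed
  then show ?thesis by blast
qed

lemma restrict_add_top:
  assumes E: "E \<in> vertical_strips d m" and T: "T \<in> flagged_tableaux d (shorten E m)"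
  shows "restrict (add_top E T) (column_cells d (shorten E m)) = T"
proof
  fix c
  show "restrict (add_top E T) (column_cells d (shorten E m)) c = T c"
    using flagged_tableauxD(3)[OF T, of c] column_cells_shorten[OF E]
    by (cases c) (auto simp: add_top_def)
qed

lemma add_top_restrict:
  assumes T: "T \<in> flagged_tableaux (Suc d) m" and E: "E = top_columns d m T"
  shows "add_top E (restrict T (column_cells d (shorten E m))) = T"
proof
  fix c :: "nat \<times> nat"
  have strip: "E \<in> vertical_strips d m"
    unfolding E by (rule top_columns_in_vertical_strips[OF T])
  show "add_top E (restrict T (column_cells d (shorten E m))) c = T c"
  proof (cases "c \<in> column_cells (Suc d) m \<and> c \<notin> column_cells d (shorten E m)")
    case True
    then obtain i j where ij: "c = (i, Suc j)"
      by (cases c, cases "snd c") (auto simp: column_cells_def)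
    then have "j \<in> E \<and> i = m j"
      using True column_cells_shorten[OF strip, of i "Suc j"] by simp
    then have "T c = Suc d" using E ij by (simp add: top_columns_def)
    then show ?thesis using True by (simp add: add_top_def)
  next
    case False
    then show ?thesis
      using flagged_tableauxD(3)[OF T, of c] by (auto simp: add_top_def)
  qed
qed

lemma card_flagged_tableaux_Suc:
  "card (flagged_tableaux (Suc d) m) =
    (\<Sum>E\<in>vertical_strips d m. card (flagged_tableaux d (shorten E m)))"
proof -
  have "bij_betw (\<lambda>T. (top_columns d m T,
        restrict T (column_cells d (shorten (top_columns d m T) m))))
      (flagged_tableaux (Suc d) m)
      (SIGMA E : vertical_strips d m. flagged_tableaux d (shorten E m))"
    by (rule bij_betw_byWitness[where f' = "\<lambda>(E, T). add_top E T"])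
      (auto simp: add_top_restrict top_columns_add_top restrict_add_top
        top_columns_in_vertical_strips restrict_flagged_tableau add_top_flagged_tableau)
  then have "card (flagged_tableaux (Suc d) m) =
      card (SIGMA E : vertical_strips d m. flagged_tableaux d (shorten E m))"
    by (rule bij_betw_same_card)
  also have "\<dots> = (\<Sum>E\<in>vertical_strips d m. card (flagged_tableaux d (shorten E m)))"
    by (rule card_SigmaI) (auto simp: vertical_strips_def finite_flagged_tableaux)
  finally show ?thesis .
qed

lemma antimono_shorten:
  assumes "E \<in> vertical_strips d m"
  shows "antimono_on {..<d} (shorten E m)"
  unfolding antimono_on_below_iff
proof (intro allI impI)
  fix i j assume "i \<le> j" "j < d"
  then have "int (m j) - of_bool (j \<in> E) \<le> int (m i) - of_bool (i \<in> E)"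
    using \<open>i \<le> j\<close> \<open>j < d\<close> by (intro vertical_stripD(3)[OF assms]) auto
  then show "shorten E m j \<le> shorten E m i"
    by (auto simp: shorten_def of_bool_def split: if_splits)
qed

end

section \<open>A determinant counting flagged tableaux\<close>

text \<open>
  The coefficient of \<open>x^s\<close> in \<open>(x + x^2)^a\<close> (lemma \<open>quad_coeff_eq_coeff\<close>). Negative exponents are
  admitted because a walker can be asked to step back below its starting point; the coefficient 0 then
  discards the configuration.
\<close>
definition quad_coeff :: "nat \<Rightarrow> int \<Rightarrow> real" where
  "quad_coeff a s = (if int a \<le> s then real (a choose (nat s - a)) else 0)"

lemma quad_coeff_0: "quad_coeff 0 s = (if s = 0 then 1 else 0)"
  by (auto simp: quad_coeff_def binomial_eq_0)

lemma quad_coeff_neg: "s < 0 \<Longrightarrow> quad_coeff a s = 0"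
  by (simp add: quad_coeff_def)

lemma quad_coeff_Suc: "quad_coeff (Suc a) s = quad_coeff a (s - 1) + quad_coeff a (s - 2)"
proof (cases "s < int a + 2")
  case True
  then consider "s < int a + 1" | "s = int a + 1" by linarith
  then show ?thesis by cases (auto simp: quad_coeff_def nat_add_distrib)
next
  case False
  define k where "k = nat (s - int a - 2)"
  have "s = int a + 2 + int k" using False by (simp add: k_def)
  then show ?thesis
    by (simp add: quad_coeff_def nat_add_distrib nat_diff_distrib Suc_diff_le)
qed

text \<open>
  The cancellation of crossing lattice paths, in determinant form. If the choice \<open>E\<close> of
  columns is not admissible, then either the last column became negative (a zero row), or it stayed
  nonempty (no walker is at the starting point 0 and the last matrix column vanishes), or two
  neighbouring columns of equal length got out of order, which puts two walkers in the same place
  (equal rows).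
\<close>
lemma det_quad_coeff_not_strip:
  assumes m: "antimono_on {..<Suc d} m" and E: "E \<subseteq> {..<Suc d}" "E \<notin> vertical_strips d m"
  shows "det (mat (Suc d) (Suc d)
    (\<lambda>(i, j). quad_coeff (d - j) (int (m i) - of_bool (i \<in> E) + int (d - i)))) = 0"
proof -
  let ?p = "\<lambda>i. int (m i) - of_bool (i \<in> E)"
  have le: "m b \<le> m a" if "a \<le> b" "b \<le> d" for a b
    using antimono_on_belowD[OF m, of a b] that by simp
  consider "?p d < 0" | "?p d > 0"
    | i j where "?p d = 0" "i \<le> j" "j \<le> d" "?p i < ?p j"
  proof -
    have "\<exists>i j. i \<le> j \<and> j \<le> d \<and> ?p i < ?p j" if "?p d = 0"
    proof -
      have "m d = of_bool (d \<in> E)"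
        using that by (cases "d \<in> E") auto
      then have "\<not> (\<forall>i j. i \<le> j \<longrightarrow> j \<le> d \<longrightarrow> ?p j \<le> ?p i)"
        using E unfolding vertical_strips_def by blast
      then show ?thesis by (meson not_le)
    qed
    then show thesis using that by (metis linorder_neqE)
  qed
  then show ?thesis
  proof cases
    case 1
    then show ?thesis
      by (intro det_mat_zero_row[of d]) (auto simp: quad_coeff_neg)
  next
    case 2
    have "?p i + int (d - i) \<noteq> 0" if "i < Suc d" for i
    proof (cases "i = d")
      case False
      then show ?thesis using 2 le[of i d] that by (auto simp: of_bool_def split: if_splits)
    qed (use 2 in simp)
    then show ?thesis
      by (intro det_mat_zero_column[of d]) (auto simp: quad_coeff_0)
  next
    case (3 i j)
    have "\<exists>k. i \<le> k \<and> k < j \<and> ?p k < ?p (Suc k)"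
    proof (rule ccontr)
      assume *: "\<not> ?thesis"
      have "?p (i + h) \<le> ?p i" if "i + h \<le> j" for h
        using that
      proof (induction h)
        case (Suc h)
        have "\<not> ?p (i + h) < ?p (Suc (i + h))"
          using * Suc.prems by auto
        then show ?case using Suc by simp
      qed simp
      from this[of "j - i"] 3 show False by simp
    qed
    then obtain k where k: "k < j" "?p k < ?p (Suc k)" by blast
    have "m (Suc k) \<le> m k" using le k 3 by simp
    then have step: "?p (Suc k) = ?p k + 1"
      using k(2) by (cases "k \<in> E"; cases "Suc k \<in> E") auto
    have "int (d - k) = int (d - Suc k) + 1"
      using k(1) 3(3) by simp
    then have eq: "?p k + int (d - k) = ?p (Suc k) + int (d - Suc k)"
      using step by simp
    show ?thesis
    proof (rule det_mat_equal_rows[of k "Suc k"])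
      show "k < Suc d" "Suc k < Suc d" using k(1) 3(3) by simp_all
    qed (simp_all only: eq n_not_Suc_n not_False_eq_True)
  qed
qed

text \<open>
  Pascal's rule splits every row into the two ways in which the bottom entry of a column can be
  \<open>d + 1\<close> or smaller. Of the resulting determinants the admissible ones have a unit vector as last
  column, and deleting it gives the determinant for \<open>d\<close>.
\<close>
theorem card_flagged_tableaux_eq_det:
  assumes "antimono_on {..<d} m"
  shows "real (card (flagged_tableaux d m)) =
    det (mat d d (\<lambda>(i, j). quad_coeff (d - j) (int (m i + (d - i)))))"
  using assms
proof (induction d arbitrary: m)
  case 0
  have "flagged_tableaux 0 m = {\<lambda>_. undefined}"
    by (auto simp: flagged_tableaux_def column_cells_def)
  then show ?case by simp
next
  case (Suc d)
  let ?D = "\<lambda>E. det (mat (Suc d) (Suc d)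
    (\<lambda>(i, j). quad_coeff (d - j) (int (m i) - of_bool (i \<in> E) + int (d - i))))"
  have pascal: "mat (Suc d) (Suc d) (\<lambda>(i, j). quad_coeff (Suc d - j) (int (m i + (Suc d - i)))) =
      mat (Suc d) (Suc d) (\<lambda>(i, j). quad_coeff (d - j) (int (m i) + int (d - i)) +
        quad_coeff (d - j) (int (m i) - 1 + int (d - i)))"
    by (rule eq_matI) (auto simp: Suc_diff_le quad_coeff_Suc algebra_simps)
  have "det (mat (Suc d) (Suc d) (\<lambda>(i, j). quad_coeff (Suc d - j) (int (m i + (Suc d - i))))) =
      (\<Sum>E\<in>Pow {..<Suc d}. ?D E)"
    unfolding pascal det_mat_rows_add
    by (intro sum.cong refl arg_cong[where f = det] eq_matI) auto
  also have "\<dots> = (\<Sum>E\<in>vertical_strips d m. ?D E)"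
  proof (rule sum.mono_neutral_right)
    show "vertical_strips d m \<subseteq> Pow {..<Suc d}"
      by (auto simp: vertical_strips_def)
    show "\<forall>E\<in>Pow {..<Suc d} - vertical_strips d m. ?D E = 0"
      using det_quad_coeff_not_strip[OF Suc.prems] by blast
  qed simp
  also have "\<dots> = (\<Sum>E\<in>vertical_strips d m. real (card (flagged_tableaux d (shorten E m))))"
  proof (intro sum.cong refl)
    fix E assume E: "E \<in> vertical_strips d m"
    have last: "int (m d) - of_bool (d \<in> E) = 0"
      using E by (simp add: vertical_strips_def)
    have pos: "int (m i) - of_bool (i \<in> E) = int (shorten E m i)" "0 \<le> int (m i) - of_bool (i \<in> E)"
      if "i \<le> d" for i
    proof -
      have "int (m d) - of_bool (d \<in> E) \<le> int (m i) - of_bool (i \<in> E)"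
        by (rule vertical_stripD(3)[OF E that]) simp
      then show "0 \<le> int (m i) - of_bool (i \<in> E)" using last by simp
      then show "int (m i) - of_bool (i \<in> E) = int (shorten E m i)"
        by (auto simp: shorten_def of_bool_def split: if_splits)
    qed
    have "?D E = det (mat d d
        (\<lambda>(i, j). quad_coeff (d - j) (int (m i) - of_bool (i \<in> E) + int (d - i))))"
    proof (rule det_mat_last_column)
      fix i assume "i < d"
      then have "int (m i) - of_bool (i \<in> E) + int (d - i) \<noteq> 0" using pos(2)[of i] by linarith
      then show "quad_coeff (d - d) (int (m i) - of_bool (i \<in> E) + int (d - i)) = 0"
        by (simp add: quad_coeff_0)
    qed (simp add: quad_coeff_0 last)
    also have "mat d d (\<lambda>(i, j). quad_coeff (d - j) (int (m i) - of_bool (i \<in> E) + int (d - i))) =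
        mat d d (\<lambda>(i, j). quad_coeff (d - j) (int (shorten E m i + (d - i))))"
      by (rule eq_matI) (auto simp: pos(1))
    also have "det \<dots> = real (card (flagged_tableaux d (shorten E m)))"
      by (rule Suc.IH[symmetric]) (rule antimono_shorten[OF Suc.prems E])
    finally show "?D E = real (card (flagged_tableaux d (shorten E m)))" .
  qed
  also have "\<dots> = real (card (flagged_tableaux (Suc d) m))"
    unfolding card_flagged_tableaux_Suc[OF Suc.prems] by simp
  finally show ?case by simp
qed

section \<open>Comparison of the two determinants\<close>

lemma quad_coeff_eq_coeff:
  "quad_coeff a (int s) = coeff ([:0, 1, 1:] ^ a) s"
proof (induction a arbitrary: s)
  case 0
  show ?case by (simp add: quad_coeff_0 coeff_pCons split: nat.split)
next
  case (Suc a)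
  have "quad_coeff a (int s - 1) = coeff (pCons 0 ([:0, 1, 1:] ^ a)) s"
    using Suc[of "s - 1"] by (cases s) (auto simp: quad_coeff_neg coeff_pCons)
  moreover have "quad_coeff a (int s - 2) = coeff (pCons 0 (pCons 0 ([:0, 1, 1:] ^ a))) s"
    using Suc[of "s - 2"] by (auto simp: quad_coeff_neg coeff_pCons split: nat.split)
  moreover have "[:0, 1, 1:] ^ Suc a = pCons 0 ([:0, 1, 1:] ^ a) + pCons 0 (pCons 0 ([:0, 1, 1:] ^ a :: real poly))"
    by simp
  ultimately show ?case by (simp only: quad_coeff_Suc coeff_add)
qed

text \<open>
  The coefficient of \<open>x^s\<close> in \<open>(x + x^2 + 1/4)^a = (x + 1/2)^(2a)\<close>, computed in two ways.
\<close>
lemma square_coeff_expansion: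
  "(\<Sum>b\<le>a. real (a choose b) * (1 / 4) ^ (a - b) * quad_coeff b (int s)) =
    fact (2 * a) / fact s * 2 ^ s / 4 ^ a * inv_fact_diff (2 * a) s"
proof -
  have "(\<Sum>b\<le>a. real (a choose b) * (1 / 4) ^ (a - b) * quad_coeff b (int s)) =
      coeff (([:0, 1, 1:] + [:1 / 4:]) ^ a) s"
    unfolding binomial_ring coeff_sum quad_coeff_eq_coeff
    by (intro sum.cong refl) (simp add: of_nat_poly poly_const_pow mult_ac)
  also have "[:0, 1, 1:] + [:1 / 4:] = [:1 / 2 :: real, 1:] ^ 2"
    by (simp add: power2_eq_square)
  also have "coeff (([:1 / 2 :: real, 1:] ^ 2) ^ a) s = coeff ([:1 / 2 :: real, 1:] ^ (2 * a)) s"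
    by (simp add: power_mult)
  also have "\<dots> = fact (2 * a) / fact s * 2 ^ s / 4 ^ a * inv_fact_diff (2 * a) s"
  proof (cases "s \<le> 2 * a")
    case True
    have "coeff ([:1 / 2 :: real, 1:] ^ (2 * a)) s = real (2 * a choose s) * (1 / 2) ^ (2 * a - s)"
      using coeff_linear_poly_power[OF True, of "1 / 2 :: real" 1] by simp
    also have "(1 / 2 :: real) ^ (2 * a - s) = 2 ^ s / 4 ^ a"
      using True by (simp add: power_diff power_one_over power_mult power2_eq_square field_simps
        flip: power_mult_distrib)
    finally show ?thesis
      using True by (simp add: inv_fact_diff_def binomial_fact)
  next
    case False
    then show ?thesis
      by (simp add: inv_fact_diff_def coeff_eq_0 degree_linear_power)
  qed
  finally show ?thesis .
qed

text \<open>
  The column operations given by \<open>square_coeff_expansion\<close> turn \<open>(x + x^2)^(d - j)\<close> into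
  \<open>(x + 1/2)^(2(d - j))\<close>. The exponent 0 also occurs in that expansion but has no column in the matrix;
  it contributes only to the constant coefficient, which is excluded by \<open>1 \<le> s i\<close>.
\<close>
lemma det_quad_coeff:
  assumes "\<And>i. i < d \<Longrightarrow> 1 \<le> s i"
  shows "det (mat d d (\<lambda>(i, j). quad_coeff (d - j) (int (s i)))) =
    (\<Prod>j<d. fact (2 * (d - j)) / 4 ^ (d - j)) * (\<Prod>i<d. 2 ^ s i / fact (s i)) *
    aitken d (\<lambda>j. 2 * (d - j)) s"
proof -
  \<comment> \<open>The matrix of these column operations; column \<open>b\<close> carries the exponent \<open>d - b\<close>.\<close>
  define U where "U b j = real (d - j choose (d - b)) * (1 / 4) ^ (b - j)" for b j
  have *: "(\<Sum>b<d. quad_coeff (d - b) (int (s i)) * U b j) =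
      (2 ^ s i / fact (s i)) * inv_fact_diff (2 * (d - j)) (s i) * (fact (2 * (d - j)) / 4 ^ (d - j))"
    if "i < d" "j < d" for i j
  proof -
    have "(\<Sum>b<d. quad_coeff (d - b) (int (s i)) * U b j) =
        (\<Sum>c\<in>{1..d}. quad_coeff c (int (s i)) * (real (d - j choose c) * (1 / 4) ^ (d - j - c)))"
      by (rule sum.reindex_bij_witness[of _ "\<lambda>c. d - c" "\<lambda>b. d - b"]) (auto simp: U_def)
    also have "\<dots> = (\<Sum>c\<le>d - j. real (d - j choose c) * (1 / 4) ^ (d - j - c) * quad_coeff c (int (s i)))"
    proof (rule sum.mono_neutral_cong)
      show "quad_coeff c (int (s i)) * (real (d - j choose c) * (1 / 4) ^ (d - j - c)) = 0"
        if "c \<in> {1..d} - {..d - j}" for c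
        using that by simp
      show "real (d - j choose c) * (1 / 4) ^ (d - j - c) * quad_coeff c (int (s i)) = 0"
        if "c \<in> {..d - j} - {1..d}" for c
      proof -
        have "c = 0" using that by auto
        then show ?thesis using assms[OF \<open>i < d\<close>] by (simp add: quad_coeff_0)
      qed
    qed auto
    also have "\<dots> = (2 ^ s i / fact (s i)) * inv_fact_diff (2 * (d - j)) (s i) * (fact (2 * (d - j)) / 4 ^ (d - j))"
      unfolding square_coeff_expansion by simp
    finally show ?thesis .
  qed
  have "det (mat d d (\<lambda>(i, j). U i j)) = det (mat d d (\<lambda>(i, j). U j i))"
    by (rule det_mat_transpose[symmetric])
  also have "\<dots> = 1"
    by (rule det_mat_unitriangular) (auto simp: U_def)
  finally have "det (mat d d (\<lambda>(i, j). quad_coeff (d - j) (int (s i)))) =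
      det (mat d d (\<lambda>(i, j). \<Sum>b<d. quad_coeff (d - b) (int (s i)) * U b j))"
    unfolding det_mat_mult by simp
  also have "mat d d (\<lambda>(i, j). \<Sum>b<d. quad_coeff (d - b) (int (s i)) * U b j) =
      mat d d (\<lambda>(i, j). (2 ^ s i / fact (s i)) * inv_fact_diff (2 * (d - j)) (s i) * (fact (2 * (d - j)) / 4 ^ (d - j)))"
    by (rule eq_matI) (auto simp: *)
  also have "det \<dots> = (\<Prod>i<d. 2 ^ s i / fact (s i)) *
      det (mat d d (\<lambda>(i, j). inv_fact_diff (2 * (d - j)) (s i))) *
      (\<Prod>j<d. fact (2 * (d - j)) / 4 ^ (d - j))"
    by (rule det_mat_scale)
  also have "det (mat d d (\<lambda>(i, j). inv_fact_diff (2 * (d - j)) (s i))) =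
      aitken d (\<lambda>j. 2 * (d - j)) s"
    unfolding aitken_def by (rule det_mat_transpose)
  finally show ?thesis by (simp add: mult_ac)
qed

text \<open>
  In the skew shape \<open>m\<close> lists row lengths, in the flagged tableaux it lists column lengths: the shape
  on the right is the conjugate of the inner shape on the left.
\<close>
theorem card_SYT_staircase_minus_partition:
  assumes m: "antimono_on {..<d} m" and le: "\<And>i. i < d \<Longrightarrow> m i \<le> d - i"
    and N: "(\<Sum>i<d. d - i) = N + (\<Sum>i<d. m i)"
  shows "real (card (linear_extensions row_or_column_before (skew_cells d (\<lambda>i. d - i) m))) *
      (\<Prod>i<d. fact (2 * (d - i))) =
    2 ^ N * fact N * (\<Prod>i<d. fact (m i + (d - i))) * real (card (flagged_tableaux d m))"
proof -
  let ?s = "\<lambda>i. m i + (d - i)"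
  let ?A = "aitken d (\<lambda>i. 2 * (d - i)) ?s"
  have "antimono_on {..<d} (\<lambda>i. d - i)"
    by (auto simp: antimono_on_below_iff)
  then have syt: "real (card (linear_extensions row_or_column_before (skew_cells d (\<lambda>i. d - i) m))) =
      fact N * ?A"
    using aitken_formula[OF _ m le] N by (simp add: mult_2)
  have "real (card (flagged_tableaux d m)) =
      (\<Prod>j<d. fact (2 * (d - j)) / 4 ^ (d - j)) * (\<Prod>i<d. 2 ^ ?s i / fact (?s i)) * ?A"
    unfolding card_flagged_tableaux_eq_det[OF m] by (rule det_quad_coeff) simp
  also have "\<dots> = (\<Prod>j<d. fact (2 * (d - j))) * (\<Prod>i<d. 2 ^ ?s i) * ?A /
      ((\<Prod>j<d. 4 ^ (d - j)) * (\<Prod>i<d. fact (?s i)))"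
    by (simp add: prod_dividef)
  also have "(\<Prod>j<d. 4 ^ (d - j) :: real) = 2 ^ N * (\<Prod>i<d. 2 ^ ?s i)"
  proof -
    have "(\<Prod>j<d. 4 ^ (d - j) :: real) = 2 ^ (2 * (\<Sum>j<d. d - j))"
      by (simp add: power_mult power_sum)
    also have "2 * (\<Sum>j<d. d - j) = N + (\<Sum>i<d. ?s i)"
      unfolding sum.distrib N by simp
    finally show ?thesis by (simp add: power_add power_sum)
  qed
  finally have "real (card (flagged_tableaux d m)) * (2 ^ N * (\<Prod>i<d. fact (?s i))) =
      (\<Prod>j<d. fact (2 * (d - j))) * ?A"
    by (simp add: field_simps)
  then show ?thesis
    unfolding syt by (simp add: mult_ac)
qed

section \<open>Two staircases\<close>

lemma part_staircase: "Defs.part (staircase n) i = (if 1 \<le> i then n - i else 0)"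
  by (auto simp: Defs.part_def staircase_def rev_nth)

lemma length_staircase: "length (staircase n) = n - 1"
  by (simp add: staircase_def)

lemma skew_diagram_staircases:
  "skew_diagram (staircase (Suc d)) (staircase n) =
    skew_cells d (\<lambda>i. d - i) (\<lambda>i. n - Suc i)"
  by (auto simp: skew_diagram_def diagram_def part_staircase skew_cells_def)

lemma num_SYT_staircases:
  "num_SYT (staircase (Suc d)) (staircase n) =
    card (linear_extensions row_or_column_before (skew_cells d (\<lambda>i. d - i) (\<lambda>i. n - Suc i)))"
proof -
  have "standard_tableaux (staircase (Suc d)) (staircase n) =
      linear_extensions row_or_column_before (skew_diagram (staircase (Suc d)) (staircase n))"
    unfolding standard_tableaux_def linear_extensions_def row_or_column_before_def
    by (rule Collect_cong) (auto 0 4)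
  then show ?thesis
    unfolding num_SYT_def skew_diagram_staircases by simp
qed

text \<open>
  A staircase is its own conjugate.
\<close>
lemma diagram_staircase:
  assumes "n \<le> Suc d"
  shows "diagram (staircase n) = column_cells d (\<lambda>j. n - Suc j)"
  using assms by (auto simp: diagram_def part_staircase column_cells_def)

lemma OOT_staircases:
  assumes "n \<le> Suc d"
  shows "OOT (staircase (Suc d)) (staircase n) = card (flagged_tableaux d (\<lambda>j. n - Suc j))"
proof -
  have flag: "Defs.content u < int (Defs.part (staircase (Suc d)) (d + 1 - t)) \<longleftrightarrow> snd u < t + fst u"
    if "t \<in> {1..d}" for u t
    using that by (auto simp: Defs.content_def part_staircase)
  have entries: "T u \<in> {1..d}"
    if "T \<in> semistandard_tableaux (staircase n) d" "u \<in> diagram (staircase n)" for T u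
    using that unfolding semistandard_tableaux_def by (blast dest: PiE_mem)
  have "{T \<in> semistandard_tableaux (staircase n) d. \<forall>u\<in>diagram (staircase n).
        Defs.content u < int (Defs.part (staircase (Suc d)) (d + 1 - T u))} =
      {T \<in> semistandard_tableaux (staircase n) d. \<forall>u\<in>diagram (staircase n). snd u < T u + fst u}"
    by (intro Collect_cong conj_cong refl ball_cong flag entries)
  also have "\<dots> = flagged_tableaux d (\<lambda>j. n - Suc j)"
    unfolding semistandard_tableaux_def flagged_tableaux_def diagram_staircase[OF assms] by auto
  finally show ?thesis
    unfolding OOT_def length_staircase by simp
qed

lemma sum_staircase: "2 * (\<Sum>i<d. d - i) = d * Suc d"
proof -
  have "(\<Sum>i<d. d - i) = (\<Sum>i\<in>{1..d}. i)"
    by (rule sum.reindex_bij_witness[of _ "\<lambda>i. d - i" "\<lambda>i. d - i"]) auto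
  then show ?thesis by (simp add: Sum_Icc_nat mult.commute)
qed

lemma size_difference_staircases:
  assumes "1 \<le> k"
  shows "(\<Sum>i<n + 2 * k - 1. n + 2 * k - 1 - i) =
    k * (2 * n + 2 * k - 1) + (\<Sum>i<n + 2 * k - 1. n - Suc i)"
proof -
  obtain h where k: "k = Suc h" using assms by (cases k) auto
  have "(\<Sum>i<n + 2 * k - 1. n - Suc i) = (\<Sum>i<n. n - Suc i)"
    by (rule sum.mono_neutral_right) (use k in auto)
  moreover have "(\<Sum>i<n. n - Suc i) + n = (\<Sum>i<n. n - i)"
  proof -
    have "(\<Sum>i<n. n - Suc i) + (\<Sum>i<n. 1) = (\<Sum>i<n. n - i)"
      unfolding sum.distrib[symmetric] by (intro sum.cong) auto
    then show ?thesis by simp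
  qed
  ultimately show ?thesis
    using sum_staircase[of "n + 2 * k - 1"] sum_staircase[of n] unfolding k
    by (simp add: algebra_simps)
qed

text \<open>
  Here the numbers from 1 to \<open>2k + 1\<close> are sorted by parity.
\<close>
lemma prod_fact_parity:
  "(\<Prod>t\<in>{1..<2 * Suc k}. fact t) =
    (\<Prod>a\<in>{1..<Suc k}. fact (2 * a)) * (\<Prod>i=1..Suc k. fact (2 * i - 1) :: real)"
proof (induction k)
  case (Suc k)
  have "{1..<2 * Suc (Suc k)} = insert (2 * Suc (Suc k) - 1) (insert (2 * Suc k) {1..<2 * Suc k})"
    by auto
  then have "(\<Prod>t\<in>{1..<2 * Suc (Suc k)}. fact t) =
      fact (2 * Suc (Suc k) - 1) * (fact (2 * Suc k) * (\<Prod>t\<in>{1..<2 * Suc k}. fact t :: real))"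
    by (simp only:) (subst prod.insert; simp)+
  also have "(\<Prod>a\<in>{1..<Suc (Suc k)}. fact (2 * a)) =
      fact (2 * Suc k) * (\<Prod>a\<in>{1..<Suc k}. fact (2 * a) :: real)"
    by (subst prod.atLeastLessThan_Suc) auto
  then have "fact (2 * Suc (Suc k) - 1) * (fact (2 * Suc k) * (\<Prod>t\<in>{1..<2 * Suc k}. fact t :: real)) =
      (\<Prod>a\<in>{1..<Suc (Suc k)}. fact (2 * a)) * (\<Prod>i=1..Suc (Suc k). fact (2 * i - 1))"
    unfolding Suc.IH by (simp only: prod.nat_ivl_Suc' mult_ac)
  finally show ?case .
qed (simp add: numeral_2_eq_2)

text \<open>
  The numbers \<open>2(d - i)\<close> are the even numbers from 2 to \<open>2(n + 2k - 1)\<close>, while the shifted parts of the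
  inner staircase are the even numbers from \<open>2k\<close> to \<open>2(n + k - 1)\<close> together with all numbers from 1 to
  \<open>2k - 1\<close>. After cancellation there remain the \<open>k\<close> largest even numbers against the first \<open>k\<close> odd ones.
\<close>
lemma prod_fact_staircases:
  assumes "1 \<le> k" and d: "d = n + 2 * k - 1"
  shows "(\<Prod>i<d. fact (2 * (d - i))) * (\<Prod>i=1..k. fact (2 * i - 1)) =
    (\<Prod>i<d. fact (n - Suc i + (d - i))) * (\<Prod>i=1..k. fact (2 * n + 2 * i + 2 * k - 2) :: real)"
proof -
  let ?F = "\<lambda>A. \<Prod>a\<in>A. fact (2 * a) :: real"
  obtain h where k: "k = Suc h" using assms by (cases k) auto
  have "(\<Prod>i<d. fact (2 * (d - i))) = ?F {1..<n + 2 * k}"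
    by (rule prod.reindex_bij_witness[of _ "\<lambda>a. d - a" "\<lambda>i. d - i"]) (auto simp: d)
  \<comment> \<open>even numbers below \<open>2k\<close>, shifted parts of the first \<open>n\<close> rows, and the \<open>k\<close> numbers of the denominator\<close>
  also have "{1..<n + 2 * k} = {1..<k} \<union> {k..<n + k} \<union> {n + k..<n + 2 * k}"
    using k by auto
  also have "?F \<dots> = ?F {1..<k} * ?F {k..<n + k} * ?F {n + k..<n + 2 * k}"
    by (subst prod.union_disjoint, auto)+
  also have "?F {n + k..<n + 2 * k} = (\<Prod>i=1..k. fact (2 * n + 2 * i + 2 * k - 2))"
    by (rule prod.reindex_bij_witness[of _ "\<lambda>i. n + k + i - 1" "\<lambda>a. a + 1 - n - k"])
      (auto simp: algebra_simps)
  finally have even: "(\<Prod>i<d. fact (2 * (d - i))) =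
    ?F {1..<k} * ?F {k..<n + k} * (\<Prod>i=1..k. fact (2 * n + 2 * i + 2 * k - 2))" .
  have "(\<Prod>i<d. fact (n - Suc i + (d - i)) :: real) =
      (\<Prod>i\<in>{..<n} \<union> {n..<d}. fact (n - Suc i + (d - i)))"
    by (rule prod.cong) (auto simp: d k)
  also have "\<dots> = (\<Prod>i<n. fact (n - Suc i + (d - i))) * (\<Prod>i\<in>{n..<d}. fact (n - Suc i + (d - i)))"
    by (rule prod.union_disjoint) auto
  \<comment> \<open>for \<open>i < n\<close> the shifted part is \<open>2(n + k - 1 - i)\<close>, for larger \<open>i\<close> it is \<open>d - i\<close>\<close>
  also have "(\<Prod>i<n. fact (n - Suc i + (d - i)) :: real) = ?F {k..<n + k}"
    by (rule prod.reindex_bij_witness[of _ "\<lambda>a. n + k - 1 - a" "\<lambda>i. n + k - 1 - i"])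
      (auto simp: d k diff_mult_distrib2 mult_2 add.assoc)
  also have "(\<Prod>i\<in>{n..<d}. fact (n - Suc i + (d - i)) :: real) = (\<Prod>t\<in>{1..<2 * k}. fact t)"
    by (rule prod.reindex_bij_witness[of _ "\<lambda>t. d - t" "\<lambda>i. d - i"]) (auto simp: d k)
  also have "\<dots> = ?F {1..<k} * (\<Prod>i=1..k. fact (2 * i - 1))"
    unfolding k by (rule prod_fact_parity)
  finally show ?thesis unfolding even by (simp only: mult_ac)
qed

theorem corollary7p12:
  fixes k n :: nat
  assumes "k \<ge> 1"
  shows "real (num_SYT (staircase (n + 2 * k)) (staircase n)) =
    2 ^ (k * (2 * n + 2 * k - 1)) * fact (k * (2 * n + 2 * k - 1)) *
    (\<Prod>i = 1..k. fact (2 * i - 1) / fact (2 * n + 2 * i + 2 * k - 2)) *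
    real (OOT (staircase (n + 2 * k)) (staircase n))"
proof -
  define d where "d = n + 2 * k - 1"
  define N where "N = k * (2 * n + 2 * k - 1)"
  define m where "m = (\<lambda>i. n - Suc i)"
  let ?P = "\<Prod>i<d. fact (2 * (d - i)) :: real"
  let ?S = "\<Prod>i<d. fact (m i + (d - i)) :: real"
  let ?O = "\<Prod>i=1..k. fact (2 * i - 1) :: real"
  let ?B = "\<Prod>i=1..k. fact (2 * n + 2 * i + 2 * k - 2) :: real"
  have d: "n + 2 * k = Suc d" "n \<le> d" using assms by (auto simp: d_def)
  let ?f = "real (num_SYT (staircase (n + 2 * k)) (staircase n))"
  let ?o = "real (OOT (staircase (n + 2 * k)) (staircase n))"
  have "?f * ?P = 2 ^ N * fact N * ?S * ?o"
    unfolding d(1) num_SYT_staircases OOT_staircases[OF le_SucI[OF d(2)]] m_def[symmetric]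
  proof (rule card_SYT_staircase_minus_partition)
    show "antimono_on {..<d} m" by (auto simp: antimono_on_below_iff m_def)
    show "m i \<le> d - i" if "i < d" for i using d(2) by (simp add: m_def)
    show "(\<Sum>i<d. d - i) = N + (\<Sum>i<d. m i)"
      unfolding N_def m_def d_def by (rule size_difference_staircases[OF assms])
  qed
  moreover have "?P * ?O = ?S * ?B"
    unfolding m_def by (rule prod_fact_staircases[OF assms d_def])
  moreover have "?P \<noteq> 0" "?B \<noteq> 0" by (simp_all add: prod_zero_iff)
  ultimately have "?f = 2 ^ N * fact N * (?O / ?B) * ?o"
  proof -
    assume *: "?f * ?P = 2 ^ N * fact N * ?S * ?o" "?P * ?O = ?S * ?B" "?P \<noteq> 0" "?B \<noteq> 0"
    have "?S = ?P * ?O / ?B" using *(2,4) by (simp add: field_simps)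
    then have "?f * ?P = (2 ^ N * fact N * (?O / ?B) * ?o) * ?P"
      unfolding *(1) by simp
    then show ?thesis by (simp only: mult_right_cancel[OF *(3)])
  qed
  then show ?thesis
    unfolding N_def prod_dividef .
qed

end
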